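(* Let $X$ be a real Hilbert space, let $Z$ be a nonempty closed convex subset of $X$, and let $(x_n)_{n\in\mathbb{N}}$ be a sequence in $X$ that is Fejér monotone with respect to $Z$. Suppose that $(x_n)_{n\in\mathbb{N}}$ converges strongly to some $\bar z\in X$ and that, for every $n\in\mathbb{N}$, $x_{n+1}\neq x_n$ and $x_n\neq \bar z$. Then $$\mathcal{C}\left(\left(\frac{x_n-x_{n+1}}{\|x_n-x_{n+1}\|}\right)_{n\in\mathbb{N}}\right)\cup \mathcal{C}\left(\left(\frac{x_n-\bar z}{\|x_n-\bar z\|}\right)_{n\in\mathbb{N}}\right)\subseteq (Z-\bar z)^{\ominus}.$$ In particular, if $\bar z\in Z$, then $(Z-\bar z)^{\ominus}$ may be replaced by $N_Z(\bar z)$ in this inclusion.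
   Context: $X$ is a real Hilbert space with inner product $\langle\cdot,\cdot\rangle$ and induced norm $\|\cdot\|$; $\mathbb{N}=\{0,1,2,\ldots\}$. A sequence $(x_n)_{n\in\mathbb{N}}$ in $X$ is Fejér monotone with respect to $C\subseteq X$ if $\|x_{n+1}-c\|\le\|x_n-c\|$ for all $c\in C$ and all $n\in\mathbb{N}$. For a sequence $(y_n)_{n\in\mathbb{N}}$ in $X$, $\mathcal{C}((y_n)_{n\in\mathbb{N}})$ denotes the set of its weak cluster points, i.e. of all $y\in X$ that are the weak limit of some subsequence of $(y_n)_{n\in\mathbb{N}}$. For $C\subseteq X$, the polar cone is $C^{\ominus}=\{u\in X : \sup_{c\in C}\langle c,u\rangle\le 0\}$. If $z\in C$, the normal cone of $C$ at $z$ is $N_C(z)=(C-z)^{\ominus}$. *)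

theory Defs
  imports "HOL-Analysis.Analysis"
begin

definition fejer_monotone :: "(nat \<Rightarrow> 'a::real_inner) \<Rightarrow> 'a set \<Rightarrow> bool" where
  "fejer_monotone x C \<longleftrightarrow> (\<forall>c\<in>C. \<forall>n. norm (x (Suc n) - c) \<le> norm (x n - c))"

(* Weak convergence in a Hilbert space, where the continuous linear functionals
   are the maps inner _ u. *)
definition weakly_converges :: "(nat \<Rightarrow> 'a::real_inner) \<Rightarrow> 'a \<Rightarrow> bool" where
  "weakly_converges y l \<longleftrightarrow> (\<forall>u. (\<lambda>n. inner (y n) u) \<longlonglongrightarrow> inner l u)"

definition weak_cluster_points :: "(nat \<Rightarrow> 'a::real_inner) \<Rightarrow> 'a set" where
  "weak_cluster_points y =
     {l. \<exists>k::nat \<Rightarrow> nat. strict_mono k \<and> weakly_converges (y \<circ> k) l}"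

(* The supremum is taken in the extended reals: it may be infinite, and it is
   minus infinity for empty C. *)
definition polar_cone :: "'a::real_inner set \<Rightarrow> 'a set" where
  "polar_cone C = {u. (SUP c\<in>C. ereal (inner c u)) \<le> 0}"

(* Outside C the normal cone is empty, the usual convention of convex analysis. *)
definition normal_cone :: "'a::real_inner set \<Rightarrow> 'a \<Rightarrow> 'a set" where
  "normal_cone C z = (if z \<in> C then polar_cone ((\<lambda>c. c - z) ` C) else {})"

end

theory Submission
  imports Defs
begin

text \<open>
  Write \<open>a\<close> and \<open>b\<close> for two points such that \<open>b\<close> is at least as close to every point
  of \<open>Z\<close> as \<open>a\<close> is. Expanding the squared norms shows that the direction of the step from \<open>b\<close>
  back to \<open>a\<close> has inner product at most \<open>norm (a - b) / 2\<close> with \<open>z - b\<close>, for every \<open>z \<in> Z\<close>. If now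
  \<open>a\<close> and \<open>b\<close> run through two sequences with the same limit \<open>zbar\<close>, replacing \<open>b\<close> by \<open>zbar\<close>
  costs only \<open>norm (b - zbar)\<close> because the direction has norm at most one. So the inner product
  of the direction with \<open>z - zbar\<close> is bounded above by a null sequence, and every weak cluster
  point of the directions lies in the polar cone
  (lemma \<open>weak_cluster_points_directions_subset_polar_cone\<close>).

  Both kinds of direction in the theorem are of this form with \<open>a = x n\<close>: take
  \<open>b = x (Suc n)\<close> for the first and \<open>b = zbar\<close> for the second. The constant sequence \<open>zbar\<close>
  qualifies because the distances from \<open>x n\<close> to a point of \<open>Z\<close> decrease to the distance
  from \<open>zbar\<close> to that point.
\<close>

lemma polar_cone_iff: "u \<in> polar_cone C \<longleftrightarrow> (\<forall>c\<in>C. inner c u \<le> 0)"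
  by (simp add: polar_cone_def SUP_le_iff)

text \<open>
  The difference of the two squared distances is
  \<open>(norm (a - b))\<^sup>2 - 2 * inner (a - b) (z - b)\<close>, and it is nonnegative; dividing by
  \<open>norm (a - b)\<close> gives the bound.
\<close>

lemma inner_direction_le_half_norm:
  fixes a b z :: "'a::real_inner"
  assumes "norm (b - z) \<le> norm (a - z)"
  shows "inner ((a - b) /\<^sub>R norm (a - b)) (z - b) \<le> norm (a - b) / 2"
proof (cases "a = b")
  case False
  have "inner (b - z) (b - z) \<le> inner (a - z) (a - z)"
    using assms by (simp add: norm_le)
  then have "2 * inner (a - b) (z - b) \<le> inner (a - b) (a - b)"
    by (simp add: inner_diff_left inner_diff_right inner_commute)
  then have "inner (a - b) (z - b) \<le> norm (a - b) * norm (a - b) / 2"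
    by (simp add: norm_eq_sqrt_inner)
  with False have "inner (a - b) (z - b) / norm (a - b) \<le> norm (a - b) / 2"
    by (simp add: pos_divide_le_eq)
  then show ?thesis
    by (simp only: inner_scaleR_left divide_inverse mult.commute)
qed simp

lemma inner_direction_le:
  fixes a b z p :: "'a::real_inner"
  assumes "norm (b - z) \<le> norm (a - z)"
  shows "inner ((a - b) /\<^sub>R norm (a - b)) (z - p) \<le> norm (a - b) / 2 + norm (b - p)"
proof -
  let ?u = "(a - b) /\<^sub>R norm (a - b)"
  have "norm ?u \<le> 1"
    by (cases "a = b") simp_all
  then have "inner ?u (b - p) \<le> norm (b - p)"
    using norm_cauchy_schwarz[of ?u "b - p"] mult_right_mono[of "norm ?u" 1 "norm (b - p)"]
    by simp
  moreover have "inner ?u (z - p) = inner ?u (z - b) + inner ?u (b - p)"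
    by (simp only: inner_add_right[symmetric] diff_add_cancel add_diff_eq)
  ultimately show ?thesis
    using inner_direction_le_half_norm[OF assms] by linarith
qed

lemma weak_cluster_point_inner_le:
  assumes "l \<in> weak_cluster_points y"
    and "\<And>n. inner (y n) u \<le> e n"
    and "e \<longlonglongrightarrow> r"
  shows "inner l u \<le> r"
proof -
  from assms(1) obtain k :: "nat \<Rightarrow> nat"
    where k: "strict_mono k" and "weakly_converges (y \<circ> k) l"
    by (auto simp: weak_cluster_points_def)
  then have "(\<lambda>n. inner (y (k n)) u) \<longlonglongrightarrow> inner l u"
    by (simp add: weakly_converges_def)
  moreover have "(\<lambda>n. e (k n)) \<longlonglongrightarrow> r"
    using LIMSEQ_subseq_LIMSEQ[OF assms(3) k] by (simp add: o_def)
  ultimately show ?thesis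
    using assms(2) by (intro LIMSEQ_le) auto
qed

text \<open>
  Keeping two independent sequences lets the same argument serve both for the
  successive steps and for the displacements from the limit.
\<close>

lemma weak_cluster_points_directions_subset_polar_cone:
  fixes a b :: "nat \<Rightarrow> 'a::real_inner"
  assumes closer: "\<And>n z. z \<in> Z \<Longrightarrow> norm (b n - z) \<le> norm (a n - z)"
    and a: "a \<longlonglongrightarrow> p" and b: "b \<longlonglongrightarrow> p"
  shows "weak_cluster_points (\<lambda>n. (a n - b n) /\<^sub>R norm (a n - b n))
           \<subseteq> polar_cone ((\<lambda>z. z - p) ` Z)"
proof
  fix l
  assume l: "l \<in> weak_cluster_points (\<lambda>n. (a n - b n) /\<^sub>R norm (a n - b n))"
  have "(\<lambda>n. norm (a n - b n) / 2 + norm (b n - p)) \<longlonglongrightarrow> norm (p - p) / 2 + norm (p - p)"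
    by (intro tendsto_intros a b) simp
  then have "(\<lambda>n. norm (a n - b n) / 2 + norm (b n - p)) \<longlonglongrightarrow> 0"
    by simp
  then have "inner l (z - p) \<le> 0" if "z \<in> Z" for z
    using inner_direction_le[OF closer[OF that]]
    by (intro weak_cluster_point_inner_le[OF l])
  then show "l \<in> polar_cone ((\<lambda>z. z - p) ` Z)"
    by (auto simp: polar_cone_iff inner_commute)
qed

lemma fejer_monotone_limit_closer:
  assumes "fejer_monotone x C" and "x \<longlonglongrightarrow> p" and "c \<in> C"
  shows "norm (p - c) \<le> norm (x n - c)"
proof (rule decseq_ge)
  show "decseq (\<lambda>n. norm (x n - c))"
    using assms(1,3) by (auto simp: decseq_Suc_iff fejer_monotone_def)
  show "(\<lambda>n. norm (x n - c)) \<longlonglongrightarrow> norm (p - c)"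
    by (intro tendsto_intros assms(2))
qed

theorem theorem3p1:
  fixes Z :: "'a::{real_inner, complete_space} set"
    and x :: "nat \<Rightarrow> 'a"
    and zbar :: 'a
  assumes "Z \<noteq> {}" and "closed Z" and "convex Z"
    and "fejer_monotone x Z"
    and "x \<longlonglongrightarrow> zbar"
    and "\<And>n. x (Suc n) \<noteq> x n"
    and "\<And>n. x n \<noteq> zbar"
  shows "weak_cluster_points (\<lambda>n. (x n - x (Suc n)) /\<^sub>R norm (x n - x (Suc n)))
           \<union> weak_cluster_points (\<lambda>n. (x n - zbar) /\<^sub>R norm (x n - zbar))
         \<subseteq> polar_cone ((\<lambda>z. z - zbar) ` Z)
       \<and> (zbar \<in> Z \<longrightarrow>
           weak_cluster_points (\<lambda>n. (x n - x (Suc n)) /\<^sub>R norm (x n - x (Suc n)))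
             \<union> weak_cluster_points (\<lambda>n. (x n - zbar) /\<^sub>R norm (x n - zbar))
           \<subseteq> normal_cone Z zbar)"
proof -
  have steps: "weak_cluster_points (\<lambda>n. (x n - x (Suc n)) /\<^sub>R norm (x n - x (Suc n)))
      \<subseteq> polar_cone ((\<lambda>z. z - zbar) ` Z)"
    using assms(4,5)
    by (intro weak_cluster_points_directions_subset_polar_cone)
      (auto simp: fejer_monotone_def intro: LIMSEQ_Suc)
  have displacements: "weak_cluster_points (\<lambda>n. (x n - zbar) /\<^sub>R norm (x n - zbar))
      \<subseteq> polar_cone ((\<lambda>z. z - zbar) ` Z)"
    using assms(4,5)
    by (intro weak_cluster_points_directions_subset_polar_cone)
      (auto intro: fejer_monotone_limit_closer)
  show ?thesis
    using steps displacements by (simp add: normal_cone_def)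
qed

end
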